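(* Let $\lambda\in\mathbb{N}$. Each $GL_2(\mathbb{Z})$-conjugacy class of integer $2\times2$ matrices with eigenvalues $\lambda$ and $0$ has a unique representative $$\begin{pmatrix}\lambda&\mu\\0&0\end{pmatrix}\quad\text{with }\mu\in[0,\tfrac12\lambda]\cap\mathbb{Z}.$$ This matrix comes from an $\varepsilon$-class of full lattices in $A=\mathbb{Q}e_1\oplus\mathbb{Q}e_2$ whose order has the $\mathbb{Z}$-basis $(\alpha e_1,\,e_1+e_2)$, where $\alpha=\lambda/\gcd(\lambda,\mu)$.
   Context: $\mathbb{N}=\{1,2,\dots\}$. $A=\mathbb{Q}e_1\oplus\mathbb{Q}e_2$ is the $\mathbb{Q}$-algebra with $e_ie_j=\delta_{ij}e_i$, so $1_A=e_1+e_2$. A full lattice in $A$ is a finitely generated $\mathbb{Z}$-submodule generating $A$ over $\mathbb{Q}$. Its order is $\mathcal{O}(L)=\{x\in A:xL\subset L\}$. Two full lattices are $\varepsilon$-equivalent if $L_2=uL_1$ for a unit $u$ of $A$. An $\varepsilon$-class $[L]_\varepsilon$ with $\mathcal{O}(L)\supset\mathbb{Z}[\lambda e_1]$ corresponds to the $GL_2(\mathbb{Z})$-conjugacy class of the matrices $M\in M_{2\times2}(\mathbb{Z})$ with $(\lambda e_1b_1,\lambda e_1b_2)=(b_1,b_2)\cdot M$, where $(b_1,b_2)$ runs through the $\mathbb{Z}$-bases of $L$; one says that $M$ comes from this $\varepsilon$-class. Here the $j$-th entry of $(b_1,b_2)\cdot M$ is $\sum_i m_{ij}b_i$. This gives a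 bijection between such $\varepsilon$-classes and conjugacy classes of integer $2\times2$ matrices with eigenvalues $\lambda$ and $0$. *)

theory Defs
  imports "HOL-Analysis.Analysis" "Jordan_Normal_Form.Spectral_Radius"
begin

text \<open>
  The algebra \<open>A = \<rat> e\<^sub>1 \<oplus> \<rat> e\<^sub>2\<close> is the type \<open>rat ^ 2\<close> of Cartesian vectors, whose
  multiplication and unit are componentwise. Integer matrices are those of
  Jordan_Normal_Form (indexed from 0), where \<open>similar_mat\<close> over \<open>int\<close> is conjugacy under
  the integer matrices with a two-sided integer inverse, i.e. under \<open>GL\<^sub>2(\<int>)\<close>.
\<close>

type_synonym alg = "rat ^ 2"

definition e1 :: alg where "e1 = axis 1 1"
definition e2 :: alg where "e2 = axis 2 1"

lemma alg_idempotents: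
  "e1 * e1 = e1" "e2 * e2 = e2" "e1 * e2 = 0" "e2 * e1 = 0" "e1 + e2 = 1"
  by (simp_all add: e1_def e2_def Finite_Cartesian_Product.vec_eq_iff axis_def forall_2)

interpretation zmod: Modules.module "\<lambda>(k::int) (x::alg). of_int k * x"
  by unfold_locales (simp_all add: algebra_simps)

definition full_lattice :: "alg set \<Rightarrow> bool" where
  "full_lattice L \<longleftrightarrow> (\<exists>B. finite B \<and> L = zmod.span B) \<and> vec.span L = UNIV"

definition is_Z_basis :: "alg \<Rightarrow> alg \<Rightarrow> alg set \<Rightarrow> bool" where
  "is_Z_basis b1 b2 L \<longleftrightarrow>
     b1 \<noteq> b2 \<and> zmod.independent {b1, b2} \<and> zmod.span {b1, b2} = L"

definition lattice_order :: "alg set \<Rightarrow> alg set" where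
  "lattice_order L = {x. \<forall>y\<in>L. x * y \<in> L}"

definition eps_rel :: "(alg set \<times> alg set) set" where
  "eps_rel = {(L1, L2). full_lattice L1 \<and> full_lattice L2 \<and> (\<exists>u. u dvd 1 \<and> L2 = (\<lambda>x. u * x) ` L1)}"

definition eps_classes :: "alg set set set" where
  "eps_classes = Collect full_lattice // eps_rel"

definition Z_adjoin :: "alg \<Rightarrow> alg set" where
  "Z_adjoin x = range (\<lambda>p :: int poly. poly (map_poly of_int p) x)"

text \<open>
  The condition on the order does not depend on the chosen \<open>L \<in> C\<close>, as \<open>A\<close> is commutative.
  The two equations are the columns of \<open>(\<lambda>e\<^sub>1b\<^sub>1, \<lambda>e\<^sub>1b\<^sub>2) = (b\<^sub>1, b\<^sub>2) \<cdot> M\<close>.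
\<close>

definition comes_from :: "nat \<Rightarrow> int mat \<Rightarrow> alg set set \<Rightarrow> bool" where
  "comes_from l M C \<longleftrightarrow> M \<in> carrier_mat 2 2 \<and> C \<in> eps_classes \<and>
     (\<exists>L\<in>C. Z_adjoin (of_nat l * e1) \<subseteq> lattice_order L \<and>
        (\<exists>b1 b2. is_Z_basis b1 b2 L \<and>
           of_nat l * e1 * b1 = of_int (M $$ (0, 0)) * b1 + of_int (M $$ (1, 0)) * b2 \<and>
           of_nat l * e1 * b2 = of_int (M $$ (0, 1)) * b1 + of_int (M $$ (1, 1)) * b2))"

text \<open>
  Eigenvalues are taken over \<open>\<complex>\<close>; for \<open>l \<noteq> 0\<close> each of \<open>l\<close> and \<open>0\<close> is automatically simple.
\<close>

definition conj_classes :: "nat \<Rightarrow> int mat set set" where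
  "conj_classes l =
     {M \<in> carrier_mat 2 2. spectrum (map_mat complex_of_int M) = {of_nat l, 0}}
       // {(M, N). similar_mat M N}"

definition rep_mat :: "nat \<Rightarrow> int \<Rightarrow> int mat" where
  "rep_mat l m = mat_of_rows_list 2 [[int l, m], [0, 0]]"

end

theory Submission imports Defs begin

text \<open>
  An integer matrix with eigenvalues \<open>\<lambda>\<close> and \<open>0\<close> has trace \<open>\<lambda>\<close> and determinant \<open>0\<close>. Hence
  \<open>M - \<lambda>\<close> is a singular integer matrix and has a primitive integer kernel vector, which
  Bezout's identity completes to a \<open>\<int>\<close>-basis of \<open>\<int>\<^sup>2\<close>. In this basis the first column of \<open>M\<close>
  is \<open>(\<lambda>, 0)\<close>, and the trace forces the second row to vanish
  (\<open>similar_rep_mat_of_trace_det\<close>). So only the upper right entry \<open>\<mu>\<close> remains free. An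
  integer matrix that conjugates one such form into another must preserve the eigenline of
  \<open>\<lambda>\<close>, so it is upper triangular with diagonal entries \<open>\<plusminus>1\<close>; its effect on \<open>\<mu>\<close> is a
  translation by a multiple of \<open>\<lambda>\<close>, up to sign (\<open>similar_rep_mat_iff\<close>). The interval
  \<open>[0, \<lambda>/2]\<close> is a fundamental domain for these moves on \<open>\<int>\<close>.

  For the lattices, the two column equations are solved by \<open>b\<^sub>1 = \<lambda> e\<^sub>1\<close> and
  \<open>b\<^sub>2 = \<mu> e\<^sub>1 + e\<^sub>2\<close>. Let \<open>L\<close> be the lattice that they span. An element \<open>x\<^sub>1 e\<^sub>1 + x\<^sub>2 e\<^sub>2\<close>
  maps \<open>b\<^sub>1\<close> into \<open>L\<close> iff \<open>x\<^sub>1\<close> is an integer, and, given this, it maps \<open>b\<^sub>2\<close> into \<open>L\<close> iff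
  \<open>x\<^sub>2\<close> is an integer and \<open>\<lambda>\<close> divides \<open>(x\<^sub>1 - x\<^sub>2) \<mu>\<close>, that is, \<open>\<alpha> = \<lambda> / gcd(\<lambda>, \<mu>)\<close>
  divides \<open>x\<^sub>1 - x\<^sub>2\<close>. These are the integral combinations of \<open>\<alpha> e\<^sub>1\<close> and \<open>e\<^sub>1 + e\<^sub>2\<close>
  (\<open>lattice_order_rep_basis\<close>), and the order is the same for all lattices in an
  \<open>\<epsilon>\<close>-class because \<open>A\<close> is commutative.
\<close>

section \<open>Two-by-two matrices\<close>

definition mat22 :: "'a \<Rightarrow> 'a \<Rightarrow> 'a \<Rightarrow> 'a \<Rightarrow> 'a mat" where
  "mat22 a b c d = mat_of_rows_list 2 [[a, b], [c, d]]"

lemma mat22_dim [simp]: "dim_row (mat22 a b c d) = 2" "dim_col (mat22 a b c d) = 2"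
  by (simp_all add: mat22_def mat_of_rows_list_def)

lemma mat22_carrier [simp]: "mat22 a b c d \<in> carrier_mat 2 2"
  by (simp add: carrier_matI)

lemma mat22_index [simp]:
  "mat22 a b c d $$ (0, 0) = a" "mat22 a b c d $$ (0, Suc 0) = b"
  "mat22 a b c d $$ (Suc 0, 0) = c" "mat22 a b c d $$ (Suc 0, Suc 0) = d"
  by (simp_all add: mat22_def mat_of_rows_list_def)

lemma mat22_eqI:
  assumes "M \<in> carrier_mat 2 2"
  shows "M = mat22 (M $$ (0,0)) (M $$ (0,1)) (M $$ (1,0)) (M $$ (1,1))"
  using assms by (auto intro!: eq_matI simp: less_2_cases_iff)

lemma mat22_cases:
  assumes "M \<in> carrier_mat 2 2"
  obtains a b c d where "M = mat22 a b c d"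
  using mat22_eqI[OF assms] by blast

lemma mat22_inject [simp]:
  "mat22 a b c d = mat22 a' b' c' d' \<longleftrightarrow> a = a' \<and> b = b' \<and> c = c' \<and> d = d'"
  by (metis mat22_index)

lemma sum_upto_2: "sum f {0..<2::nat} = f 0 + f 1"
  by (simp add: numeral_2_eq_2)

lemma mat22_mult [simp]:
  fixes a :: "'a::comm_ring_1"
  shows "mat22 a b c d * mat22 a' b' c' d' =
    mat22 (a * a' + b * c') (a * b' + b * d') (c * a' + d * c') (c * b' + d * d')"
  by (rule eq_matI) (auto simp: less_2_cases_iff scalar_prod_def sum_upto_2)

lemma one_mat22: "1\<^sub>m 2 = mat22 1 0 0 (1::'a::comm_ring_1)"
  by (rule eq_matI) (auto simp: less_2_cases_iff)

text \<open>
  Multiplying the two eigenvector equations by the adjugate of \<open>M - k\<close> shows that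
  \<open>det (M - k)\<close> annihilates both coordinates of the eigenvector, and one of them is nonzero.
\<close>

lemma eigenvalue_mat22:
  fixes a :: "'a::idom"
  assumes "eigenvalue (mat22 a b c d) k"
  shows "(a - k) * (d - k) = b * c"
proof -
  obtain v where v: "v \<in> carrier_vec 2" "v \<noteq> 0\<^sub>v 2" and eq: "mat22 a b c d *\<^sub>v v = k \<cdot>\<^sub>v v"
    using assms by (auto simp: eigenvalue_def eigenvector_def)
  define x y where "x = v $ 0" and "y = v $ 1"
  have "(mat22 a b c d *\<^sub>v v) $ 0 = k * x" "(mat22 a b c d *\<^sub>v v) $ 1 = k * y"
    using v(1) by (simp_all add: eq x_def y_def)
  hence xy: "a * x + b * y = k * x" "c * x + d * y = k * y"
    using v(1) by (simp_all add: x_def y_def scalar_prod_def sum_upto_2)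
  have "x \<noteq> 0 \<or> y \<noteq> 0"
    using v by (auto simp: x_def y_def less_2_cases_iff intro!: eq_vecI)
  moreover have "((a - k) * (d - k) - b * c) * x =
      (d - k) * (a * x + b * y - k * x) - b * (c * x + d * y - k * y)"
    "((a - k) * (d - k) - b * c) * y =
      (a - k) * (c * x + d * y - k * y) - c * (a * x + b * y - k * x)"
    by (simp_all add: algebra_simps)
  hence "((a - k) * (d - k) - b * c) * x = 0" "((a - k) * (d - k) - b * c) * y = 0"
    using xy by simp_all
  ultimately show ?thesis by auto
qed

section \<open>Conjugacy of two-by-two integer matrices\<close>

lemma rep_mat_eq: "rep_mat l m = mat22 (int l) m 0 0"
  by (simp add: rep_mat_def mat22_def)

text \<open>
  Conjugacy written as \<open>A P = P B\<close> with \<open>det P = \<plusminus>1\<close> avoids inverse matrices and leaves four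
  linear equations in the entries of \<open>P\<close>. The adjugate divided by the determinant supplies
  the integer inverse.
\<close>

lemma similar_mat22I:
  fixes a :: int
  assumes det: "p * s - q * r = 1 \<or> p * s - q * r = -1"
    and eq: "mat22 a b c d * mat22 p q r s = mat22 p q r s * mat22 a' b' c' d'"
  shows "similar_mat (mat22 a b c d) (mat22 a' b' c' d')"
proof -
  obtain e where e: "p * s - q * r = e" "e = 1 \<or> e = -1" using det by blast
  \<comment> \<open>The factor \<open>e\<close> divides the adjugate by the determinant, since \<open>1 / e = e\<close>.\<close>
  define P Q where "P = mat22 p q r s" and "Q = mat22 (e * s) (- e * q) (- e * r) (e * p)"
  have PQ: "P * Q = 1\<^sub>m 2" "Q * P = 1\<^sub>m 2"
    unfolding P_def Q_def one_mat22 mat22_mult mat22_inject using e(2,1) by (elim disjE; simp add: algebra_simps)+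
  have "mat22 a b c d = mat22 a b c d * (P * Q)" by (simp add: PQ)
  also have "\<dots> = mat22 a b c d * P * Q"
    by (rule assoc_mult_mat[symmetric, where ?n\<^sub>2.0=2 and ?n\<^sub>3.0=2]) (auto simp: P_def Q_def)
  also have "\<dots> = P * mat22 a' b' c' d' * Q" using eq by (simp only: P_def)
  finally show ?thesis
    by (intro similar_matI[where n=2, OF _ PQ]) (auto simp: P_def Q_def)
qed

lemma similar_mat22E:
  fixes a :: int
  assumes "similar_mat (mat22 a b c d) (mat22 a' b' c' d')"
  obtains p q r s where "p * s - q * r = 1 \<or> p * s - q * r = -1"
    "mat22 a b c d * mat22 p q r s = mat22 p q r s * mat22 a' b' c' d'"
proof -
  let ?A = "mat22 a b c d" and ?B = "mat22 a' b' c' d'"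
  obtain P Q where "similar_mat_wit ?A ?B P Q"
    using assms unfolding similar_mat_def by blast
  note wit = similar_mat_witD2[OF mat22_carrier this]
  note PQ = wit(1-3) and c = wit(6,7)
  have "?A * P = P * ?B * (Q * P)"
    unfolding PQ(3) by (rule assoc_mult_mat[of _ 2 2 _ 2 _ 2]) (use c in auto)
  also have "\<dots> = P * ?B" unfolding PQ(2) using c by (auto intro!: right_mult_one_mat[where nr = 2])
  finally have AP: "?A * P = P * ?B" .
  obtain p q r s where P: "P = mat22 p q r s" using mat22_cases[OF c(1)] .
  obtain p' q' r' s' where Q: "Q = mat22 p' q' r' s'" using mat22_cases[OF c(2)] .
  have "p * p' + q * r' = 1" "p * q' + q * s' = 0" "r * p' + s * r' = 0" "r * q' + s * s' = 1"
    using PQ(1) by (simp_all add: P Q one_mat22)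
  \<comment> \<open>Multiplicativity of the determinant, with the entries of \<open>P Q\<close> on the right-hand side.\<close>
  moreover have "(p * s - q * r) * (p' * s' - q' * r') =
      (p * p' + q * r') * (r * q' + s * s') - (p * q' + q * s') * (r * p' + s * r')"
    by (simp add: algebra_simps)
  ultimately have "(p * s - q * r) * (p' * s' - q' * r') = 1" by simp
  hence "p * s - q * r = 1 \<or> p * s - q * r = -1" using zmult_eq_1_iff by blast
  thus ?thesis using that AP by (simp only: P)
qed

text \<open>
  The eigenvalue \<open>0\<close> gives the determinant. Subtracting it from the equation for the
  eigenvalue \<open>\<lambda>\<close> leaves \<open>\<lambda> (a + d - \<lambda>) = 0\<close>, where \<open>\<lambda>\<close> cancels.
\<close>

lemma trace_det_of_spectrum:
  assumes "l \<ge> 1"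
    and "spectrum (map_mat complex_of_int (mat22 a b c d)) = {of_nat l, 0}"
  shows "a + d = int l" "a * d = b * c"
proof -
  have map: "map_mat complex_of_int (mat22 a b c d) =
      mat22 (of_int a) (of_int b) (of_int c) (of_int d)"
    by (rule eq_matI) (auto simp: less_2_cases_iff)
  have ev: "(of_int a - k) * (of_int d - k) = of_int b * of_int c"
    if "k \<in> {of_nat l, 0}" for k :: complex
    using that assms(2) eigenvalue_mat22 unfolding map spectrum_def by blast
  have "complex_of_int (a * d) = of_int (b * c)"
    using ev[of 0] by simp
  thus det: "a * d = b * c" by (simp only: of_int_eq_iff)
  have "complex_of_int ((a - int l) * (d - int l)) = of_int (b * c)"
    using ev[of "of_nat l"] by simp
  hence "(a - int l) * (d - int l) = b * c" by (simp only: of_int_eq_iff)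
  hence "int l * (a + d - int l) = 0" using det by (simp add: algebra_simps)
  thus "a + d = int l" using assms(1) by simp
qed

section \<open>Reduction to the triangular representatives\<close>

text \<open>
  A nonzero row \<open>(x, y)\<close> is orthogonal to \<open>(y, -x)\<close>. Dividing this vector by \<open>gcd x y\<close> makes
  it primitive, and it also kills the other row because the rows are linearly dependent.
\<close>

lemma primitive_kernel_vector:
  fixes x y z w :: int
  assumes "x * w = y * z"
  obtains p q where "coprime p q" "x * p + y * q = 0" "z * p + w * q = 0"
proof -
  have orth: "\<exists>p q. coprime p q \<and> x * p + y * q = 0 \<and> z * p + w * q = 0"
    if "x \<noteq> 0 \<or> y \<noteq> 0" and eq: "x * w = y * z" for x y z w :: int
  proof -
    let ?g = "gcd x y"
    have g: "?g \<noteq> 0" using that by simp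
    then obtain x' y' where xy: "x = x' * ?g" "y = y' * ?g" "coprime x' y'"
      using gcd_coprime_exists[of x y] by auto
    have "x' * ?g * w = y' * ?g * z"
      using eq by (subst xy(1)[symmetric], subst xy(2)[symmetric])
    hence "(x' * w) * ?g = (y' * z) * ?g" by (simp only: ac_simps)
    hence "x' * w = y' * z" using g by (metis mult_right_cancel)
    hence "z * y' + w * (- x') = 0" by (simp add: mult.commute)
    moreover have "x * y' + y * (- x') = x' * ?g * y' - y' * ?g * x'"
      by (subst xy(1)[symmetric], subst xy(2)[symmetric]) simp
    hence "x * y' + y * (- x') = 0" by simp
    moreover have "coprime y' (- x')" using xy(3) by (simp add: coprime_commute)
    ultimately show ?thesis by blast
  qed
  consider "x \<noteq> 0 \<or> y \<noteq> 0" | "z \<noteq> 0 \<or> w \<noteq> 0" | "x = 0" "y = 0" "z = 0" "w = 0" by blast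
  thus ?thesis
  proof cases
    case 1
    thus ?thesis using orth[of x y w z] assms that by blast
  next
    case 2
    thus ?thesis using orth[of z w y x] assms that by (auto simp: mult.commute)
  next
    case 3
    show ?thesis by (rule that[of 1 0]) (simp_all add: 3)
  qed
qed

text \<open>
  The basis change has the primitive eigenvector \<open>(p, q)\<close> for \<open>\<lambda>\<close> as its first column and
  the Bezout complement \<open>(-w, u)\<close> as its second. By Cayley-Hamilton,
  \<open>(M - \<lambda>) M = 0\<close>, so \<open>M\<close> maps the second basis vector into the kernel of \<open>M - \<lambda>\<close>. For
  \<open>M \<noteq> \<lambda>\<close> this is the line of \<open>(p, q)\<close>, and \<open>M = \<lambda>\<close> is possible only if both are \<open>0\<close>; in
  either case the image is an integer multiple of \<open>(p, q)\<close>, and the factor is the entry \<open>m\<close>.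
\<close>

lemma similar_rep_mat_of_trace_det:
  assumes tr: "a + d = int l" and det: "a * d = b * c"
  obtains m where "similar_mat (mat22 a b c d) (rep_mat l m)"
proof -
  have eqs: "a - int l = - d" "d - int l = - a" using tr by simp_all
  have "(a - int l) * (d - int l) = b * c"
    unfolding eqs using det by (simp add: mult.commute)
  then obtain p q where pq: "coprime p q" "(a - int l) * p + b * q = 0" "c * p + (d - int l) * q = 0"
    using primitive_kernel_vector by blast
  obtain u w where uw: "u * p + w * q = 1"
    using bezout_int[of p q] pq(1) by (auto simp: coprime_iff_gcd_eq_1)
  \<comment> \<open>\<open>(x, y)\<close> is the image of \<open>(-w, u)\<close>. Once it is known to be parallel to \<open>(p, q)\<close>, pairing it
    with \<open>(u, w)\<close> reads off the factor, because \<open>u p + w q = 1\<close>.\<close>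
  define x y m where "x = b * u - a * w" and "y = d * u - c * w" and "m = u * x + w * y"
  have "p * y - q * x = u * (d * p - b * q) + w * (a * q - c * p)"
    by (simp add: x_def y_def algebra_simps)
  also have "\<dots> = 0" using pq(2,3) unfolding eqs by simp
  finally have par: "p * y = q * x" by simp
  have "m * p = (u * p) * x + w * (p * y)" "m * q = u * (q * x) + (w * q) * y"
    by (simp_all add: m_def algebra_simps)
  hence "m * p = (u * p + w * q) * x" "m * q = (u * p + w * q) * y"
    by (simp_all add: par[symmetric] algebra_simps)
  hence v2: "b * u - a * w = m * p" "d * u - c * w = m * q"
    using uw by (simp_all add: x_def y_def)
  have "similar_mat (mat22 a b c d) (mat22 (int l) m 0 0)"
  proof (rule similar_mat22I)
    show "p * u - (- w) * q = 1 \<or> p * u - (- w) * q = -1" using uw by (simp add: algebra_simps)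
    show "mat22 a b c d * mat22 p (- w) q u = mat22 p (- w) q u * mat22 (int l) m 0 0"
      using pq(2,3) v2 by (simp add: algebra_simps)
  qed
  thus ?thesis using that by (simp add: rep_mat_eq)
qed

text \<open>
  Comparing the lower left entries of \<open>A P = P B\<close> gives \<open>r \<lambda> = 0\<close>. So \<open>P\<close> is upper triangular
  with diagonal entries \<open>\<plusminus>1\<close>, and the upper right entries give \<open>\<lambda> q + m s = p n\<close>, which
  relates \<open>n\<close> to \<open>\<plusminus>m\<close> modulo \<open>\<lambda>\<close>. The free entry \<open>q\<close> realizes every such relation.
\<close>

lemma similar_rep_mat_iff:
  assumes "l \<ge> 1"
  shows "similar_mat (rep_mat l m) (rep_mat l n) \<longleftrightarrow> int l dvd m - n \<or> int l dvd m + n"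
proof
  assume "similar_mat (rep_mat l m) (rep_mat l n)"
  then obtain p q r s where det: "p * s - q * r = 1 \<or> p * s - q * r = -1"
    and "mat22 (int l) m 0 0 * mat22 p q r s = mat22 p q r s * mat22 (int l) n 0 0"
    unfolding rep_mat_eq by (rule similar_mat22E)
  hence eq: "r * int l = 0" "int l * q + m * s = p * n" by simp_all
  hence "r = 0" using assms by simp
  with det have "p * s = 1 \<or> p * s = -1" by simp
  hence "(p = 1 \<or> p = -1) \<and> (s = p \<or> s = - p)"
    by (metis zmult_eq_1_iff minus_mult_right minus_equation_iff minus_minus)
  then consider "m - n = int l * (- q)" | "m - n = int l * q" | "m + n = int l * (- q)" | "m + n = int l * q"
    using eq(2) by (elim conjE disjE) (force simp: algebra_simps)+
  thus "int l dvd m - n \<or> int l dvd m + n" by cases (metis dvd_triv_left)+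
next
  assume "int l dvd m - n \<or> int l dvd m + n"
  thus "similar_mat (rep_mat l m) (rep_mat l n)"
  proof
    assume "int l dvd m - n"
    then obtain x where "m - n = int l * x" ..
    thus ?thesis unfolding rep_mat_eq
      by (intro similar_mat22I[of 1 1 "- x" 0]) simp_all
  next
    assume "int l dvd m + n"
    then obtain x where "m + n = int l * x" ..
    thus ?thesis unfolding rep_mat_eq
      by (intro similar_mat22I[of 1 "- 1" x 0]) simp_all
  qed
qed

lemma half_range_representative:
  fixes l m :: int
  assumes "l \<ge> 1"
  obtains n where "0 \<le> n" "2 * n \<le> l" "l dvd m - n \<or> l dvd m + n"
proof (cases "2 * (m mod l) \<le> l")
  case True
  thus ?thesis using assms by (intro that[of "m mod l"]) auto
next
  case False
  have "m + (l - m mod l) = l * (m div l + 1)"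
    using mult_div_mod_eq[of l m] by (simp add: algebra_simps)
  hence "l dvd m + (l - m mod l)" by (metis dvd_triv_left)
  moreover have "m mod l < l" using assms by simp
  ultimately show ?thesis using False by (intro that[of "l - m mod l"]) auto
qed

lemma half_range_unique:
  fixes l m n :: int
  assumes "l \<ge> 1" "0 \<le> m" "2 * m \<le> l" "0 \<le> n" "2 * n \<le> l" "l dvd m - n \<or> l dvd m + n"
  shows "m = n"
  using assms(6)
proof
  assume "l dvd m - n"
  thus ?thesis using assms(1-5) zdvd_not_zless[of "\<bar>m - n\<bar>" l] by force
next
  assume "l dvd m + n"
  hence "m + n = 0 \<or> l \<le> m + n" using assms(2,4) zdvd_imp_le by force
  thus ?thesis using assms(2-5) by linarith
qed

section \<open>The unique representative of a conjugacy class\<close>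

lemma conj_class_representative:
  assumes l: "l \<ge> 1" and K: "K \<in> conj_classes l"
  shows "\<exists>!m. 0 \<le> m \<and> 2 * m \<le> int l \<and> rep_mat l m \<in> K"
proof -
  obtain M where M: "M \<in> carrier_mat 2 2" "spectrum (map_mat complex_of_int M) = {of_nat l, 0}"
    and K_eq: "K = {N. similar_mat M N}"
    using K by (auto simp: conj_classes_def elim!: quotientE)
  obtain a b c d where abcd: "M = mat22 a b c d" using mat22_cases[OF M(1)] .
  obtain m0 where m0: "similar_mat M (rep_mat l m0)"
    using similar_rep_mat_of_trace_det trace_det_of_spectrum[OF l] M(2) unfolding abcd by metis
  obtain m where m: "0 \<le> m" "2 * m \<le> int l" "int l dvd m0 - m \<or> int l dvd m0 + m"
    using half_range_representative[of "int l" m0] l by auto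
  show ?thesis
  proof (rule ex1I)
    show "0 \<le> m \<and> 2 * m \<le> int l \<and> rep_mat l m \<in> K"
      using m m0 similar_rep_mat_iff[OF l] by (auto simp: K_eq intro: similar_mat_trans)
  next
    fix n assume n: "0 \<le> n \<and> 2 * n \<le> int l \<and> rep_mat l n \<in> K"
    hence "similar_mat (rep_mat l n) M" by (auto simp: K_eq intro: similar_mat_sym)
    moreover have "similar_mat M (rep_mat l m)"
      using m m0 similar_rep_mat_iff[OF l] by (auto intro: similar_mat_trans)
    ultimately have "similar_mat (rep_mat l n) (rep_mat l m)" by (rule similar_mat_trans)
    thus "n = m" using half_range_unique[of "int l" n m] similar_rep_mat_iff[OF l] l m n by auto
  qed
qed

section \<open>The algebra and its lattices in coordinates\<close>

lemma alg_eq_iff: "x = y \<longleftrightarrow> x $ 1 = y $ 1 \<and> x $ 2 = y $ 2" for x y :: alg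
  by (simp add: Finite_Cartesian_Product.vec_eq_iff forall_2)

lemma alg_components [simp]:
  "(e1 :: alg) $ 1 = 1" "(e1 :: alg) $ 2 = 0" "(e2 :: alg) $ 1 = 0" "(e2 :: alg) $ 2 = 1"
  "(1 :: alg) $ i = 1" "(of_nat n :: alg) $ i = of_nat n" "(of_int k :: alg) $ i = of_int k"
proof -
  show nat: "(of_nat n :: alg) $ i = of_nat n" for n by (induction n) simp_all
  show "(of_int k :: alg) $ i = of_int k" by (cases k rule: int_cases2) (simp_all add: nat)
qed (simp_all add: e1_def e2_def axis_def)

lemma zmod_span_pair: "zmod.span {b1, b2} = {of_int h * b1 + of_int k * b2 | h k. True}"
proof -
  have "x \<in> zmod.span {b1, b2} \<longleftrightarrow> (\<exists>h k. x = of_int h * b1 + of_int k * b2)" for x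
  proof -
    have "x \<in> zmod.span {b1, b2} \<longleftrightarrow> (\<exists>h k. x - of_int h * b1 - of_int k * b2 = 0)"
      by (simp add: zmod.span_breakdown_eq)
    also have "\<dots> \<longleftrightarrow> (\<exists>h k. x = of_int h * b1 + of_int k * b2)"
      by (simp only: diff_diff_eq right_minus_eq)
    finally show ?thesis .
  qed
  thus ?thesis by blast
qed

lemma is_Z_basisI:
  assumes ind: "\<And>h k. of_int h * b1 + of_int k * b2 = 0 \<Longrightarrow> h = 0 \<and> k = 0"
    and L: "L = {of_int h * b1 + of_int k * b2 | h k. True}"
  shows "is_Z_basis b1 b2 L"
proof -
  have ne: "b1 \<noteq> b2" using ind[of 1 "-1"] by auto
  have "zmod.independent {b1, b2}"
    using ind ne by (auto simp: zmod.dependent_finite)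
  with ne L show ?thesis by (auto simp: is_Z_basis_def zmod_span_pair)
qed

section \<open>The lattice of a representative and its order\<close>

text \<open>
  The generators solve \<open>\<lambda> e\<^sub>1 b\<^sub>1 = \<lambda> b\<^sub>1\<close> and \<open>\<lambda> e\<^sub>1 b\<^sub>2 = m b\<^sub>1\<close>. The first equation says that
  \<open>b\<^sub>1\<close> is a multiple of \<open>e\<^sub>1\<close>, and the second fixes the \<open>e\<^sub>1\<close>-coordinate of \<open>b\<^sub>2\<close>. The remaining
  two scalars are a unit of \<open>A\<close>, so the choice does not affect the \<open>\<epsilon>\<close>-class.
\<close>

definition rep_lattice :: "nat \<Rightarrow> int \<Rightarrow> alg set" where
  "rep_lattice l m = {of_int h * (of_nat l * e1) + of_int k * (of_int m * e1 + e2) | h k. True}"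

lemma mem_rep_lattice_iff:
  "x \<in> rep_lattice l m \<longleftrightarrow> (\<exists>h k. x $ 1 = of_int (int l * h + m * k) \<and> x $ 2 = of_int k)"
  unfolding rep_lattice_def by (auto simp: alg_eq_iff algebra_simps)

lemma rep_lattice_basis:
  assumes "l \<ge> 1"
  shows "is_Z_basis (of_nat l * e1) (of_int m * e1 + e2) (rep_lattice l m)"
  using assms by (intro is_Z_basisI) (auto simp: rep_lattice_def alg_eq_iff)

lemma full_lattice_rep_lattice:
  assumes "l \<ge> 1"
  shows "full_lattice (rep_lattice l m)"
proof -
  let ?b1 = "of_nat l * e1 :: alg" and ?b2 = "of_int m * e1 + e2 :: alg"
  have eq: "rep_lattice l m = zmod.span {?b1, ?b2}"
    unfolding rep_lattice_def zmod_span_pair ..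
  have b: "?b1 \<in> rep_lattice l m" "?b2 \<in> rep_lattice l m"
    unfolding eq by (auto intro: zmod.span_base)
  have "x \<in> vec.span (rep_lattice l m)" for x :: alg
  proof -
    have "((x $ 1 - of_int m * x $ 2) / of_nat l) *s ?b1 + (x $ 2) *s ?b2 \<in> vec.span (rep_lattice l m)"
      by (intro vec.span_add vec.span_scale vec.span_base b)
    moreover have "((x $ 1 - of_int m * x $ 2) / of_nat l) *s ?b1 + (x $ 2) *s ?b2 = x"
      using assms by (simp add: alg_eq_iff)
    ultimately show ?thesis by simp
  qed
  hence "vec.span (rep_lattice l m) = UNIV" by blast
  moreover have "\<exists>B. finite B \<and> rep_lattice l m = zmod.span B"
    by (rule exI[of _ "{?b1, ?b2}"]) (simp add: eq)
  ultimately show ?thesis by (simp add: full_lattice_def)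
qed

text \<open>
  It suffices to test \<open>x\<close> on the two generators: the first forces \<open>x $ 1\<close> to be an integer,
  the second forces \<open>x $ 2\<close> to be an integer and leaves the divisibility condition.
\<close>

lemma mem_lattice_order_rep_iff:
  assumes l: "l \<ge> 1"
  shows "x \<in> lattice_order (rep_lattice l m) \<longleftrightarrow>
    (\<exists>p q. x $ 1 = of_int p \<and> x $ 2 = of_int q \<and> int l dvd (p - q) * m)" (is "?A \<longleftrightarrow> ?B")
proof
  assume x: ?A
  have b: "of_nat l * e1 \<in> rep_lattice l m" "of_int m * e1 + e2 \<in> rep_lattice l m"
    using rep_lattice_basis[OF l] unfolding is_Z_basis_def by (auto intro: zmod.span_base)
  have xb: "x * (of_nat l * e1) \<in> rep_lattice l m" "x * (of_int m * e1 + e2) \<in> rep_lattice l m"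
    using x b by (simp_all add: lattice_order_def)
  from xb(1) obtain p where "x $ 1 * of_nat l = of_int (int l * p)"
    unfolding mem_rep_lattice_iff by auto
  hence p: "x $ 1 = of_int p" using l by simp
  from xb(2) obtain h q where "x $ 1 * of_int m = of_int (int l * h + m * q)" and q: "x $ 2 = of_int q"
    unfolding mem_rep_lattice_iff by auto
  hence "of_int (p * m) = (of_int (int l * h + m * q) :: rat)" using p by simp
  hence "p * m = int l * h + m * q" by (simp only: of_int_eq_iff)
  hence "(p - q) * m = int l * h" by (simp add: algebra_simps)
  thus ?B using p q by auto
next
  assume ?B
  then obtain p q where pq: "x $ 1 = of_int p" "x $ 2 = of_int q" and "int l dvd (p - q) * m"
    by blast
  then obtain t where t: "(p - q) * m = int l * t" by (elim dvdE)
  have "x * y \<in> rep_lattice l m" if y: "y \<in> rep_lattice l m" for y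
  proof -
    obtain h k where hk: "y $ 1 = of_int (int l * h + m * k)" "y $ 2 = of_int k"
      using y unfolding mem_rep_lattice_iff by blast
    have "p * (int l * h + m * k) = int l * (p * h + t * k) + m * (q * k)"
    proof -
      have "p * (int l * h + m * k) = int l * (p * h) + ((p - q) * m) * k + m * (q * k)"
        by (simp add: algebra_simps)
      thus ?thesis unfolding t by (simp add: algebra_simps)
    qed
    hence "(x * y) $ 1 = of_int (int l * (p * h + t * k) + m * (q * k))"
      by (simp only: vector_mult_component pq hk of_int_mult[symmetric])
    moreover have "(x * y) $ 2 = of_int (q * k)" by (simp add: pq hk)
    ultimately show ?thesis unfolding mem_rep_lattice_iff by blast
  qed
  thus ?A by (simp add: lattice_order_def)
qed

text \<open>
  As \<open>\<alpha> = \<lambda> / gcd(\<lambda>, m)\<close> is coprime to \<open>m / gcd(\<lambda>, m)\<close>, the condition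
  \<open>\<lambda> dvd (p - q) * m\<close> reduces to \<open>\<alpha> dvd p - q\<close>. Then \<open>p e\<^sub>1 + q e\<^sub>2\<close> is
  \<open>q (e\<^sub>1 + e\<^sub>2)\<close> plus a multiple of \<open>\<alpha> e\<^sub>1\<close>.
\<close>

lemma lattice_order_rep_basis:
  assumes l: "l \<ge> 1"
  shows "is_Z_basis ((of_nat l / of_int (gcd (int l) m)) *s e1) (e1 + e2)
    (lattice_order (rep_lattice l m))"
proof -
  let ?g = "gcd (int l) m"
  define \<alpha> where "\<alpha> = int l div ?g"
  have g: "?g \<noteq> 0" using l by simp
  have l_eq: "int l = \<alpha> * ?g" by (simp add: \<alpha>_def)
  have scalar: "(of_nat l / of_int ?g :: rat) = of_int \<alpha>"
  proof -
    have "(of_nat l :: rat) = of_int (int l)" by simp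
    also have "\<dots> = of_int \<alpha> * of_int ?g" by (subst l_eq) simp
    finally show ?thesis using g by simp
  qed
  have \<alpha>: "\<alpha> \<noteq> 0" using l l_eq by auto
  have dvd: "int l dvd d * m \<longleftrightarrow> \<alpha> dvd d" for d
  proof -
    have "int l dvd d * m \<longleftrightarrow> \<alpha> * ?g dvd d * (m div ?g) * ?g"
      by (simp only: l_eq[symmetric] mult.assoc dvd_div_mult_self[OF gcd_dvd2])
    also have "\<dots> \<longleftrightarrow> \<alpha> dvd d * (m div ?g)" using g by (simp only: dvd_mult_cancel_right) blast
    also have "\<dots> \<longleftrightarrow> \<alpha> dvd d"
      using div_gcd_coprime[of "int l" m] l by (simp add: \<alpha>_def coprime_dvd_mult_left_iff)
    finally show ?thesis .
  qed
  show ?thesis unfolding scalar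
  proof (rule is_Z_basisI)
    fix h k assume "of_int h * (of_int \<alpha> *s e1) + of_int k * (e1 + e2) = 0"
    thus "h = 0 \<and> k = 0" using \<alpha> by (auto simp: alg_eq_iff)
  next
    have "x \<in> lattice_order (rep_lattice l m) \<longleftrightarrow>
      (\<exists>h k. x = of_int h * (of_int \<alpha> *s e1) + of_int k * (e1 + e2))" for x
    proof -
      have "x \<in> lattice_order (rep_lattice l m) \<longleftrightarrow>
        (\<exists>p q. x $ 1 = of_int p \<and> x $ 2 = of_int q \<and> \<alpha> dvd p - q)"
        unfolding mem_lattice_order_rep_iff[OF l] dvd ..
      also have "\<dots> \<longleftrightarrow> (\<exists>h k. x $ 1 = of_int (h * \<alpha> + k) \<and> x $ 2 = of_int k)"
        by (metis add_diff_cancel_right' diff_add_cancel dvd_def dvd_triv_right mult.commute)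
      finally show ?thesis by (simp add: alg_eq_iff)
    qed
    thus "lattice_order (rep_lattice l m) =
      {of_int h * (of_int \<alpha> *s e1) + of_int k * (e1 + e2) | h k. True}" by blast
  qed
qed

lemma lattice_order_unit_mult:
  assumes "u dvd 1"
  shows "lattice_order ((\<lambda>x. u * x) ` L) = lattice_order L"
proof -
  obtain v where v: "u * v = 1" using assms by (metis dvdE)
  have inj: "u * x = u * y \<longleftrightarrow> x = y" for x y
  proof
    assume "u * x = u * y"
    hence "(u * v) * x = (u * v) * y" by (simp only: mult.assoc mult.left_commute[of u v])
    thus "x = y" by (simp add: v)
  qed simp
  have "x * (u * y) \<in> (\<lambda>x. u * x) ` L \<longleftrightarrow> x * y \<in> L" for x y
    by (auto simp: image_iff inj mult.left_commute[of x u])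
  thus ?thesis by (simp add: lattice_order_def)
qed

text \<open>The order of a \<open>\<int>\<close>-module is a ring containing \<open>\<int>\<close>; Horner's scheme gives the induction.\<close>

lemma Z_adjoin_subset_lattice_order:
  assumes L: "zmod.span B = L" and x: "x \<in> lattice_order L"
  shows "Z_adjoin x \<subseteq> lattice_order L"
proof -
  have "poly (map_poly of_int p) x * y \<in> L" if y: "y \<in> L" for p y
  proof (induction p)
    case 0
    show ?case using zmod.span_zero[of B] by (simp add: L)
  next
    case (pCons a p)
    have "of_int a * y \<in> L" using y unfolding L[symmetric] by (rule zmod.span_scale)
    moreover have "x * (poly (map_poly of_int p) x * y) \<in> L"
      using pCons x by (simp add: lattice_order_def)
    ultimately have "of_int a * y + x * (poly (map_poly of_int p) x * y) \<in> L"
      unfolding L[symmetric] by (rule zmod.span_add)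
    thus ?case by (simp add: Polynomial.map_poly_pCons distrib_right mult.assoc)
  qed
  thus ?thesis by (auto simp: Z_adjoin_def lattice_order_def)
qed

section \<open>The classification\<close>

lemma rep_mat_comes_from:
  assumes l: "l \<ge> 1"
  shows "comes_from l (rep_mat l m) (eps_rel `` {rep_lattice l m})"
proof -
  let ?L = "rep_lattice l m" and ?b1 = "of_nat l * e1 :: alg" and ?b2 = "of_int m * e1 + e2 :: alg"
  note full = full_lattice_rep_lattice[OF l, of m] and basis = rep_lattice_basis[OF l, of m]
  have "eps_rel `` {?L} \<in> eps_classes"
    unfolding eps_classes_def using full by (intro quotientI) simp
  moreover have "?L \<in> eps_rel `` {?L}"
    using full by (auto simp: eps_rel_def intro!: exI[of _ 1])
  moreover have "?b1 \<in> lattice_order ?L"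
    unfolding mem_lattice_order_rep_iff[OF l]
    by (intro exI[of _ "int l"] exI[of _ 0]) simp
  hence "Z_adjoin ?b1 \<subseteq> lattice_order ?L"
    using basis unfolding is_Z_basis_def by (intro Z_adjoin_subset_lattice_order) auto
  moreover have "?b1 * ?b1 = of_int (rep_mat l m $$ (0, 0)) * ?b1 + of_int (rep_mat l m $$ (1, 0)) * ?b2"
    "?b1 * ?b2 = of_int (rep_mat l m $$ (0, 1)) * ?b1 + of_int (rep_mat l m $$ (1, 1)) * ?b2"
    by (simp_all add: rep_mat_eq alg_eq_iff)
  ultimately show ?thesis
    unfolding comes_from_def using basis by (auto simp: rep_mat_eq)
qed

theorem theorem9p4:
  fixes l :: nat
  assumes "l \<ge> 1"
  shows "(\<forall>K\<in>conj_classes l. \<exists>!m::int. 0 \<le> m \<and> 2 * m \<le> int l \<and> rep_mat l m \<in> K) \<and>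
    (\<forall>m::int. 0 \<le> m \<and> 2 * m \<le> int l \<longrightarrow>
       (\<exists>C. comes_from l (rep_mat l m) C \<and>
          (\<forall>L\<in>C. is_Z_basis ((of_nat l / of_int (gcd (int l) m)) *s e1) (e1 + e2)
                    (lattice_order L))))"
proof (intro conjI ballI allI impI)
  fix K assume "K \<in> conj_classes l"
  thus "\<exists>!m. 0 \<le> m \<and> 2 * m \<le> int l \<and> rep_mat l m \<in> K"
    by (rule conj_class_representative[OF assms])
next
  fix m :: int
  have "lattice_order L = lattice_order (rep_lattice l m)"
    if "L \<in> eps_rel `` {rep_lattice l m}" for L
    using that lattice_order_unit_mult by (auto simp: eps_rel_def)
  thus "\<exists>C. comes_from l (rep_mat l m) C \<and>
      (\<forall>L\<in>C. is_Z_basis ((of_nat l / of_int (gcd (int l) m)) *s e1) (e1 + e2) (lattice_order L))"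
    using rep_mat_comes_from[OF assms] lattice_order_rep_basis[OF assms] by metis
qed

end
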